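(* Let $\mathfrak g$ be a complex simple Lie algebra and $\mathfrak l\subset\mathfrak g$ a Levi subalgebra. If $\chi$ is a regular character of $\mathfrak l$, then $\rho_{\mathbf t(\chi)}=r_{\mathfrak l}^{\mathfrak g}(\chi)$, where $\mathbf t(\chi)=(e^{(\bar\alpha_s,\chi)})_{s\in\bar I}$.
   Context: $\mathfrak h\subset\mathfrak l$ is a Cartan subalgebra of $\mathfrak g$, $\mathfrak z$ the center of $\mathfrak l$, $\alpha_s$ ($s\in[1,r]$) simple roots of $\mathfrak g$, $I\subset[1,r]$ the set of indices of simple roots of $\mathfrak l$, $\bar I=[1,r]\setminus I$, $\Delta_+(\mathfrak l)\subset\Delta_+(\mathfrak g)$ the positive roots. For $\alpha\in\Delta_+(\mathfrak g)\setminus\Delta_+(\mathfrak l)$, $\bar\alpha=\alpha_{|\mathfrak z}\in\mathfrak z^*$ (nonzero); $\Delta_+(\mathfrak g;\mathfrak l)$ is the set of all such $\bar\alpha$. Each $\theta\in\Delta_+(\mathfrak g;\mathfrak l)$ is uniquely $\sum_{s\in\bar I}n_s(\theta)\bar\alpha_s$ with nonnegative integers $n_s(\theta)$; $\chi_\theta(\mathbf t)=\prod_{s\in\bar I}t_s^{n_s(\theta)}$ for $\mathbf t=(t_s)\in(\mathbb C^\times)^{\bar I}$. $e_\alpha\in\mathfrak g_\alpha$, $f_\alpha\in\mathfrak g_{-\alpha}$ satisfy $\langle e_\alpha,f_\alpha\rangle=1$ for the Killing form; $x\wedge y=x\otimes y-y\otimes x$. For $\mathbf t\in(\mathbb C^\times)^{\bar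 I}$ with $\chi_\theta(\mathbf t)\neq1$ for all $\theta\in\Delta_+(\mathfrak g;\mathfrak l)$, $$\rho_{\mathbf t}=\frac12\sum_{\theta\in\Delta_+(\mathfrak g;\mathfrak l)}\frac{1+\chi_\theta(\mathbf t)}{1-\chi_\theta(\mathbf t)}\sum_{\alpha\in\Delta_+(\mathfrak g)\setminus\Delta_+(\mathfrak l),\ \bar\alpha=\theta}e_\alpha\wedge f_\alpha .$$ Characters of $\mathfrak l$ are identified with $\mathfrak z^*$, viewed inside $\mathfrak h^*$ by extension by zero on $\mathfrak h\cap[\mathfrak l,\mathfrak l]$. For $\alpha\in\Delta_+(\mathfrak l)$ and $\chi$ a character, $(\chi,\alpha)=0$; for $\alpha\in\Delta_+(\mathfrak g)\setminus\Delta_+(\mathfrak l)$, $(\chi,\alpha)$ depends only on $\bar\alpha$ and is written $(\bar\alpha,\chi)$. $\chi$ is regular if $(\theta,\chi)\notin2\pi i\mathbb Z$ for all $\theta\in\Delta_+(\mathfrak g;\mathfrak l)$. $r_{\mathfrak l}^{\mathfrak g}$ is the $\mathfrak l$-equivariant (dynamical $r$-matrix) function $\mathfrak l^*\to\wedge^2(\mathfrak g)$ whose restriction to $\mathfrak h^*$ is $$r_{\mathfrak l}^{\mathfrak g}(\lambda)=-\frac12\sum_{\alpha\in\Delta_+(\mathfrak g)\setminus\Delta_+(\mathfrak l)}\coth\frac{(\lambda,\alpha)}2\,e_\alpha\wedge f_\alpha+\sum_{\alpha\in\Delta_+(\mathfrak l)}\varphi((\lambda,\alpha))\,e_\alpha\wedge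 f_\alpha,\quad\varphi(x)=-\frac12\coth\frac x2+\frac1x$$ ($\varphi$ extended by $\varphi(0)=0$). *)

theory Defs
  imports "HOL-Analysis.Analysis" "HOL-Library.Function_Algebras"
begin

text \<open>
  Linear functionals are total functions of type \<open>'g \<Rightarrow> complex\<close>; a functional on a subspace
  \<open>V\<close> is represented by its extension by \<open>0\<close> to the complement of \<open>V\<close> as a set (that extension
  is not linear on the whole space, it only makes the representation unique).

  Since everything is finite dimensional, the tensor square of \<open>\<gg>\<close> is realised as the space of
  bilinear forms on the dual of \<open>\<gg>\<close>, with \<open>x \<otimes> y\<close> being \<open>(\<phi>, \<psi>) \<mapsto> \<phi> x * \<psi> y\<close>.
\<close>

type_synonym 'g functional = "'g \<Rightarrow> complex"
type_synonym 'g tensor2 = "'g functional \<Rightarrow> 'g functional \<Rightarrow> complex"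

definition coth :: "complex \<Rightarrow> complex" where
  "coth z = cosh z / sinh z"

definition phi :: "complex \<Rightarrow> complex" where
  "phi x = (if x = 0 then 0 else - (1/2) * coth (x / 2) + 1 / x)"

definition two_pi_i_Z :: "complex set" where
  "two_pi_i_Z = {2 * of_real pi * \<i> * of_int k | k :: int. True}"

definition tscale :: "complex \<Rightarrow> 'g tensor2 \<Rightarrow> 'g tensor2" where
  "tscale c T = (\<lambda>\<phi> \<psi>. c * T \<phi> \<psi>)"

text \<open>The basis is auxiliary: it only expresses finite dimensionality and computes traces.\<close>

locale fd_lie_algebra = finite_dimensional_vector_space scale Basis
  for scale :: "complex \<Rightarrow> 'g::ab_group_add \<Rightarrow> 'g" and Basis :: "'g set" +
  fixes br :: "'g \<Rightarrow> 'g \<Rightarrow> 'g"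
  assumes linear_right: "Vector_Spaces.linear scale scale (\<lambda>y. br x y)"
    and linear_left: "Vector_Spaces.linear scale scale (\<lambda>x. br x y)"
    and alternating: "br x x = 0"
    and jacobi: "br x (br y z) + br y (br z x) + br z (br x y) = 0"
begin

definition ideal :: "'g set \<Rightarrow> bool" where
  "ideal J \<longleftrightarrow> subspace J \<and> (\<forall>x. \<forall>y\<in>J. br x y \<in> J)"

definition center :: "'g set \<Rightarrow> 'g set" where
  "center V = {x \<in> V. \<forall>y\<in>V. br x y = 0}"

definition trace :: "('g \<Rightarrow> 'g) \<Rightarrow> complex" where
  "trace T = (\<Sum>b\<in>Basis. representation Basis (T b) b)"

definition killing :: "'g \<Rightarrow> 'g \<Rightarrow> complex" where
  "killing x y = trace (\<lambda>z. br x (br y z))"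

definition dual :: "'g set \<Rightarrow> 'g functional set" where
  "dual V = {\<phi>. (\<forall>x\<in>V. \<forall>y\<in>V. \<phi> (x + y) = \<phi> x + \<phi> y) \<and>
                 (\<forall>c. \<forall>x\<in>V. \<phi> (scale c x) = c * \<phi> x) \<and>
                 (\<forall>x. x \<notin> V \<longrightarrow> \<phi> x = 0)}"

definition tensor :: "'g \<Rightarrow> 'g \<Rightarrow> 'g tensor2" where
  "tensor x y = (\<lambda>\<phi> \<psi>. if \<phi> \<in> dual UNIV \<and> \<psi> \<in> dual UNIV then \<phi> x * \<psi> y else 0)"

definition wedge :: "'g \<Rightarrow> 'g \<Rightarrow> 'g tensor2" where
  "wedge x y = tensor x y - tensor y x"

definition wedge2 :: "'g tensor2 set" where
  "wedge2 = module.span tscale {wedge x y | x y. True}"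

text \<open>The action of \<open>x\<close> on tensors, \<open>a \<otimes> b \<mapsto> [x,a] \<otimes> b + a \<otimes> [x,b]\<close>.\<close>

definition ad2 :: "'g \<Rightarrow> 'g tensor2 \<Rightarrow> 'g tensor2" where
  "ad2 x T = (\<lambda>\<phi> \<psi>. T (\<lambda>z. \<phi> (br x z)) \<psi> + T \<phi> (\<lambda>z. \<psi> (br x z)))"

text \<open>The coadjoint action of \<open>x \<in> V\<close> on the dual of a subalgebra \<open>V\<close>.\<close>

definition coad :: "'g set \<Rightarrow> 'g \<Rightarrow> 'g functional \<Rightarrow> 'g functional" where
  "coad V x \<mu> = (\<lambda>y. if y \<in> V then - \<mu> (br x y) else 0)"

text \<open>
  The usual definition for semisimple complex Lie algebras: a commutative subalgebra that is its
  own centralizer and all of whose elements are ad-diagonalizable.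
\<close>

definition cartan_subalgebra :: "'g set \<Rightarrow> bool" where
  "cartan_subalgebra H \<longleftrightarrow> subspace H \<and>
     (\<forall>x\<in>H. \<forall>y\<in>H. br x y = 0) \<and>
     (\<forall>x. (\<forall>h\<in>H. br h x = 0) \<longrightarrow> x \<in> H) \<and>
     (\<forall>h\<in>H. span {x. \<exists>c. br h x = scale c x} = UNIV)"

text \<open>For \<open>H \<subseteq> V\<close>, the \<open>\<alpha>\<close>-weight space of \<open>H\<close> in \<open>V\<close>, and the roots of \<open>V\<close> with respect to \<open>H\<close>.\<close>

definition weight_space :: "'g set \<Rightarrow> 'g set \<Rightarrow> 'g functional \<Rightarrow> 'g set" where
  "weight_space H V \<alpha> = {x \<in> V. \<forall>h\<in>H. br h x = scale (\<alpha> h) x}"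

definition roots :: "'g set \<Rightarrow> 'g set \<Rightarrow> 'g functional set" where
  "roots H V = {\<alpha> \<in> dual H. \<alpha> \<noteq> 0 \<and> weight_space H V \<alpha> \<noteq> {0}}"

definition simple_roots :: "'g set \<Rightarrow> nat \<Rightarrow> (nat \<Rightarrow> 'g functional) \<Rightarrow> bool" where
  "simple_roots H n \<alpha>s \<longleftrightarrow>
     (\<forall>s\<in>{1..n}. \<alpha>s s \<in> roots H UNIV) \<and>
     (\<forall>c. (\<forall>h. (\<Sum>s=1..n. c s * \<alpha>s s h) = 0) \<longrightarrow> (\<forall>s\<in>{1..n}. c s = 0)) \<and>
     (\<forall>\<mu>\<in>dual H. \<exists>c. \<forall>h. \<mu> h = (\<Sum>s=1..n. c s * \<alpha>s s h)) \<and>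
     (\<forall>\<beta>\<in>roots H UNIV. \<exists>m :: nat \<Rightarrow> nat.
        (\<forall>h. \<beta> h = (\<Sum>s=1..n. of_nat (m s) * \<alpha>s s h)) \<or>
        (\<forall>h. \<beta> h = - (\<Sum>s=1..n. of_nat (m s) * \<alpha>s s h)))"

end

locale simple_lie_algebra = fd_lie_algebra scale Basis br
  for scale :: "complex \<Rightarrow> 'g::ab_group_add \<Rightarrow> 'g" and Basis :: "'g set"
    and br :: "'g \<Rightarrow> 'g \<Rightarrow> 'g" +
  assumes nonabelian: "\<exists>x y. br x y \<noteq> 0"
    and no_proper_ideal: "ideal J \<Longrightarrow> J = {0} \<or> J = UNIV"

locale simple_lie_algebra_with_roots = simple_lie_algebra scale Basis br
  for scale :: "complex \<Rightarrow> 'g::ab_group_add \<Rightarrow> 'g" and Basis :: "'g set"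
    and br :: "'g \<Rightarrow> 'g \<Rightarrow> 'g" +
  fixes H :: "'g set" and r :: nat and \<alpha>s :: "nat \<Rightarrow> 'g functional"
  assumes cartan: "cartan_subalgebra H"
    and simple: "simple_roots H r \<alpha>s"
begin

definition pos_roots :: "'g functional set" where
  "pos_roots = {\<beta> \<in> roots H UNIV.
     \<exists>m :: nat \<Rightarrow> nat. \<forall>h. \<beta> h = (\<Sum>s=1..r. of_nat (m s) * \<alpha>s s h)}"

text \<open>
  \<open>form \<mu> \<beta>\<close> is the pairing \<open>(\<mu>,\<beta>)\<close> on the dual of \<open>H\<close> induced by the Killing form. It depends
  only on the restriction of \<open>\<mu>\<close> to \<open>H\<close>, so \<open>\<mu>\<close> may also be a functional on a larger subspace.
\<close>

definition killing_dual :: "'g functional \<Rightarrow> 'g" where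
  "killing_dual \<beta> = (THE t. t \<in> H \<and> (\<forall>h\<in>H. killing t h = \<beta> h))"

definition form :: "'g functional \<Rightarrow> 'g functional \<Rightarrow> complex" where
  "form \<mu> \<beta> = \<mu> (killing_dual \<beta>)"

text \<open>The Levi subalgebra containing \<open>H\<close> whose simple roots are the \<open>\<alpha>s s\<close> with \<open>s \<in> I\<close>.\<close>

definition levi :: "nat set \<Rightarrow> 'g set" where
  "levi I = span (H \<union> (\<Union>\<beta> \<in> {\<beta> \<in> roots H UNIV.
     \<exists>m :: nat \<Rightarrow> int. \<forall>h. \<beta> h = (\<Sum>s\<in>I. of_int (m s) * \<alpha>s s h)}. weight_space H UNIV \<beta>))"

end

locale levi_setting = simple_lie_algebra_with_roots scale Basis br H r \<alpha>s
  for scale :: "complex \<Rightarrow> 'g::ab_group_add \<Rightarrow> 'g" and Basis :: "'g set"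
    and br :: "'g \<Rightarrow> 'g \<Rightarrow> 'g" and H :: "'g set" and r :: nat
    and \<alpha>s :: "nat \<Rightarrow> 'g functional" +
  fixes I :: "nat set" and L :: "'g set"
    and e :: "'g functional \<Rightarrow> 'g" and f :: "'g functional \<Rightarrow> 'g"
  assumes I_subset: "I \<subseteq> {1..r}"
    and L_levi: "L = levi I"
    and e_in: "\<beta> \<in> pos_roots \<Longrightarrow> e \<beta> \<in> weight_space H UNIV \<beta>"
    and f_in: "\<beta> \<in> pos_roots \<Longrightarrow> f \<beta> \<in> weight_space H UNIV (- \<beta>)"
    and ef_normalized: "\<beta> \<in> pos_roots \<Longrightarrow> killing (e \<beta>) (f \<beta>) = 1"
begin

definition Ibar :: "nat set" where
  "Ibar = {1..r} - I"

definition pos_roots_levi :: "'g functional set" where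
  "pos_roots_levi = pos_roots \<inter> roots H L"

definition bar :: "'g functional \<Rightarrow> 'g functional" where
  "bar \<beta> = (\<lambda>z. if z \<in> center L then \<beta> z else 0)"

definition rel_roots :: "'g functional set" where
  "rel_roots = bar ` (pos_roots - pos_roots_levi)"

definition mult :: "'g functional \<Rightarrow> nat \<Rightarrow> nat" where
  "mult \<theta> = (THE n. (\<forall>s. s \<notin> Ibar \<longrightarrow> n s = 0) \<and>
     (\<forall>z. \<theta> z = (\<Sum>s\<in>Ibar. of_nat (n s) * bar (\<alpha>s s) z)))"

definition chi_rel :: "'g functional \<Rightarrow> (nat \<Rightarrow> complex) \<Rightarrow> complex" where
  "chi_rel \<theta> t = (\<Prod>s\<in>Ibar. t s ^ mult \<theta> s)"

definition admissible :: "(nat \<Rightarrow> complex) \<Rightarrow> bool" where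
  "admissible t \<longleftrightarrow> (\<forall>s\<in>Ibar. t s \<noteq> 0) \<and> (\<forall>\<theta>\<in>rel_roots. chi_rel \<theta> t \<noteq> 1)"

text \<open>Meaningful only for admissible \<open>t\<close>.\<close>

definition rho :: "(nat \<Rightarrow> complex) \<Rightarrow> 'g tensor2" where
  "rho t = tscale (1/2) (\<Sum>\<theta>\<in>rel_roots.
     tscale ((1 + chi_rel \<theta> t) / (1 - chi_rel \<theta> t))
       (\<Sum>\<beta>\<in>{\<beta> \<in> pos_roots - pos_roots_levi. bar \<beta> = \<theta>}. wedge (e \<beta>) (f \<beta>)))"

definition character :: "'g functional \<Rightarrow> bool" where
  "character \<xi> \<longleftrightarrow> \<xi> \<in> dual L \<and> (\<forall>x\<in>L. \<forall>y\<in>L. \<xi> (br x y) = 0)"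

text \<open>The common value of \<open>(\<xi>,\<beta>)\<close> over all \<open>\<beta>\<close> outside the Levi subalgebra restricting to \<open>\<theta>\<close>.\<close>

definition rel_form :: "'g functional \<Rightarrow> 'g functional \<Rightarrow> complex" where
  "rel_form \<theta> \<xi> = (THE c. \<exists>\<beta> \<in> pos_roots - pos_roots_levi. bar \<beta> = \<theta> \<and> c = form \<xi> \<beta>)"

definition regular :: "'g functional \<Rightarrow> bool" where
  "regular \<xi> \<longleftrightarrow> (\<forall>\<theta>\<in>rel_roots. rel_form \<theta> \<xi> \<notin> two_pi_i_Z)"

definition t_of :: "'g functional \<Rightarrow> nat \<Rightarrow> complex" where
  "t_of \<xi> = (\<lambda>s. exp (rel_form (bar (\<alpha>s s)) \<xi>))"

text \<open>The dual of \<open>H\<close> inside the dual of \<open>L\<close>: the functionals vanishing on all root spaces of \<open>L\<close>.\<close>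

definition dual_H_in_L :: "'g functional set" where
  "dual_H_in_L = {\<mu> \<in> dual L. \<forall>\<beta> \<in> roots H L. \<forall>x \<in> weight_space H L \<beta>. \<mu> x = 0}"

definition r_on_H :: "'g functional \<Rightarrow> 'g tensor2" where
  "r_on_H \<mu> =
     tscale (- (1/2)) (\<Sum>\<beta> \<in> pos_roots - pos_roots_levi.
        tscale (coth (form \<mu> \<beta> / 2)) (wedge (e \<beta>) (f \<beta>)))
     + (\<Sum>\<beta> \<in> pos_roots_levi. tscale (phi (form \<mu> \<beta>)) (wedge (e \<beta>) (f \<beta>)))"

definition no_pole :: "'g functional \<Rightarrow> bool" where
  "no_pole \<mu> \<longleftrightarrow>
     (\<forall>\<beta> \<in> pos_roots - pos_roots_levi. form \<mu> \<beta> \<notin> two_pi_i_Z) \<and>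
     (\<forall>\<beta> \<in> pos_roots_levi. form \<mu> \<beta> \<notin> two_pi_i_Z - {0})"

text \<open>
  \<open>R\<close>, with domain of definition \<open>D\<close>, is an \<open>L\<close>-equivariant function on the dual of \<open>L\<close> with the
  prescribed restriction. The product topology on functions induces the usual topology on the dual
  of \<open>L\<close>. Equivariance is that of a Lie algebra action: the derivative of \<open>R\<close> at \<open>\<mu>\<close> along
  the coadjoint vector field of \<open>x\<close> equals \<open>x\<close> acting on \<open>R \<mu>\<close>.
\<close>

definition dynamical_r_matrix :: "'g functional set \<Rightarrow> ('g functional \<Rightarrow> 'g tensor2) \<Rightarrow> bool" where
  "dynamical_r_matrix D R \<longleftrightarrow>
     openin (top_of_set (dual L)) D \<and>
     D \<inter> dual_H_in_L = {\<mu> \<in> dual_H_in_L. no_pole \<mu>} \<and>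
     (\<forall>\<mu>\<in>D. R \<mu> \<in> wedge2) \<and>
     (\<forall>\<mu>\<in>D. \<forall>x\<in>L. \<forall>\<phi>\<in>dual UNIV. \<forall>\<psi>\<in>dual UNIV.
        ((\<lambda>\<tau>. R (\<lambda>y. \<mu> y + \<tau> * coad L x \<mu> y) \<phi> \<psi>)
           has_field_derivative ad2 x (R \<mu>) \<phi> \<psi>) (at 0)) \<and>
     (\<forall>\<mu>\<in>D \<inter> dual_H_in_L. R \<mu> = r_on_H \<mu>)"

end

end

(*
  The idea is to represent a character xi by the element t_xi of H with killing t_xi h = xi h for
  h in H. Every (xi, beta) is then beta t_xi. For a simple root alpha of the Levi subalgebra L this
  number is xi [e_alpha, f_alpha] = 0, so t_xi is central in L; hence (xi, beta) = bar beta t_xi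
  depends only on bar beta, additively, and vanishes for the roots of L. So chi_theta (t(xi)) is
  exp (xi, beta), and the coefficients agree because (1 + exp x) / (1 - exp x) = - coth (x / 2).

  Nondegeneracy of the Killing form does not need Cartan's criterion: the radical is an ideal,
  and the normalization killing e_beta f_beta = 1 shows that it is proper.
*)

theory Submission
  imports Defs
begin

section \<open>Scalar identities, tensor scaling and linear algebra\<close>

lemma coth_half:
  "(1 + exp x) / (1 - exp x) = - coth (x / 2)"
proof -
  \<comment> \<open>In terms of \<open>u\<close>, with \<open>exp x = u * u\<close>, both sides are
    rational. Where \<open>exp x = 1\<close> both denominators vanish, and both sides are 0 by the
    convention for division by zero.\<close>
  define u where "u = exp (x / 2)"
  have u0: "u \<noteq> 0" by (simp add: u_def)
  have ux: "exp x = u * u" by (simp add: u_def flip: exp_add)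
  have exp_neg: "exp (- (x / 2)) = 1 / u"
    unfolding u_def exp_minus by (rule inverse_eq_divide)
  have "coth (x / 2) = (u + 1 / u) / (u - 1 / u)"
    unfolding coth_def cosh_def sinh_def scaleR_conv_of_real exp_neg u_def[symmetric]
    by (rule mult_divide_mult_cancel_left) simp
  moreover have "u + 1 / u = (u * u + 1) / u" "u - 1 / u = (u * u - 1) / u"
    using u0 by (simp_all add: field_simps)
  ultimately have "coth (x / 2) = (u * u + 1) / (u * u - 1)"
    using u0 by simp
  also have "\<dots> = - ((1 + u * u) / (1 - u * u))"
    by (metis add.commute minus_diff_eq minus_divide_right)
  finally show ?thesis using ux by simp
qed

text \<open>Translates between the two descriptions of the poles: admissibility excludes the value 1
  of an exponential, regularity excludes exponents in \<open>two_pi_i_Z\<close>.\<close>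

lemma exp_eq_1_iff_two_pi_i_Z: "exp z = 1 \<longleftrightarrow> z \<in> two_pi_i_Z"
proof
  assume "exp z = 1"
  then obtain n :: int where "Re z = 0" "Im z = of_int (2 * n) * pi"
    by (auto simp: exp_eq_1)
  then have "z = 2 * of_real pi * \<i> * of_int n"
    by (simp add: complex_eq_iff)
  then show "z \<in> two_pi_i_Z" by (auto simp: two_pi_i_Z_def)
next
  assume "z \<in> two_pi_i_Z"
  then obtain n :: int where "z = 2 * of_real pi * \<i> * of_int n"
    by (auto simp: two_pi_i_Z_def)
  then show "exp z = 1" by (auto simp: exp_eq_1)
qed

lemma tscale_0_left [simp]: "tscale 0 T = 0"
  by (simp add: tscale_def fun_eq_iff)

lemma tscale_tscale [simp]: "tscale a (tscale b T) = tscale (a * b) T"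
  by (simp add: tscale_def mult.assoc)

lemma tscale_sum: "tscale c (sum F A) = (\<Sum>x\<in>A. tscale c (F x))"
  by (induction A rule: infinite_finite_induct)
    (auto simp: tscale_def fun_eq_iff algebra_simps)

text \<open>Induction on \<open>S\<close>: on the kernel of one functional \<open>F a\<close> the
  remaining ones suffice, and a vector outside that kernel fixes the coefficient of
  \<open>F a\<close>. The subspace \<open>V\<close> varies because each step passes to a kernel.
  Linearity is asked on \<open>V\<close> only, which suits functionals extended by 0 off a
  subspace.\<close>

lemma (in vector_space) functional_in_span_of_kernels:
  assumes "finite S" "subspace V"
    and "\<And>s x y. s \<in> S \<Longrightarrow> x \<in> V \<Longrightarrow> y \<in> V \<Longrightarrow> F s (x + y) = F s x + F s y"
    and "\<And>s c x. s \<in> S \<Longrightarrow> x \<in> V \<Longrightarrow> F s (scale c x) = c * F s x"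
    and "\<And>x y. x \<in> V \<Longrightarrow> y \<in> V \<Longrightarrow> g (x + y) = g x + g y"
    and "\<And>c x. x \<in> V \<Longrightarrow> g (scale c x) = c * g x"
    and "\<And>x. x \<in> V \<Longrightarrow> (\<And>s. s \<in> S \<Longrightarrow> F s x = 0) \<Longrightarrow> g x = 0"
  shows "\<exists>c. \<forall>x\<in>V. g x = (\<Sum>s\<in>S. c s * F s x)"
  using assms
proof (induction S arbitrary: V rule: finite_induct)
  case empty
  then show ?case by auto
next
  case (insert a S)
  note add = insert.prems(2) and hom = insert.prems(3)
  let ?W = "{x \<in> V. F a x = 0}"
  have W: "subspace ?W"
  proof (rule subspaceI)
    have "F a (scale 0 0) = 0 * F a 0"
      using hom[of a 0 0] subspace_0[OF insert.prems(1)] by blast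
    then show "0 \<in> ?W" using subspace_0[OF insert.prems(1)] by simp
  qed (use insert.prems(1) add[of a] hom[of a] in \<open>auto simp: subspace_add subspace_scale\<close>)
  have "\<exists>c. \<forall>x\<in>?W. g x = (\<Sum>s\<in>S. c s * F s x)"
  proof (rule insert.IH[OF W])
    fix x assume "x \<in> ?W" "\<And>s. s \<in> S \<Longrightarrow> F s x = 0"
    then show "g x = 0" using insert.prems(6)[of x] by auto
  qed (use insert.prems(2-5) in auto)
  then obtain c where c: "\<And>x. x \<in> V \<Longrightarrow> F a x = 0 \<Longrightarrow> g x = (\<Sum>s\<in>S. c s * F s x)"
    by blast
  show ?case
  proof (cases "\<exists>v\<in>V. F a v \<noteq> 0")
    case False
    \<comment> \<open>Here \<open>?W\<close> is all of \<open>V\<close>, and the value of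
      \<open>c\<close> at \<open>a\<close> is arbitrary.\<close>
    then have "\<forall>x\<in>V. g x = (\<Sum>s\<in>insert a S. c s * F s x)"
      using c insert.hyps by simp
    then show ?thesis by blast
  next
    case True
    then obtain v where v: "v \<in> V" "F a v \<noteq> 0" by blast
    \<comment> \<open>Forced by evaluating the desired identity at \<open>v\<close>.\<close>
    define d where "d = (g v - (\<Sum>s\<in>S. c s * F s v)) / F a v"
    have "g x = (\<Sum>s\<in>insert a S. (c(a := d)) s * F s x)" if x: "x \<in> V" for x
    proof -
      \<comment> \<open>Chosen so that \<open>x + scale k v\<close> lies in the kernel of
        \<open>F a\<close>, where \<open>c\<close> already represents \<open>g\<close>.\<close>
      define k where "k = - F a x / F a v"
      let ?y = "x + scale k v"
      have kv: "scale k v \<in> V" using v insert.prems(1) by (simp add: subspace_scale)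
      have y: "?y \<in> V" using x kv insert.prems(1) by (simp add: subspace_add)
      have F: "F s ?y = F s x + k * F s v" if "s \<in> insert a S" for s
        using add[of s x "scale k v"] hom[of s v k] that x v kv by simp
      have "F a ?y = 0" using F[of a] v by (simp add: k_def)
      then have "g ?y = (\<Sum>s\<in>S. c s * F s ?y)" using c y by blast
      also have "\<dots> = (\<Sum>s\<in>S. c s * F s x) + k * (\<Sum>s\<in>S. c s * F s v)"
        by (simp add: F sum.distrib sum_distrib_left algebra_simps)
      finally have "g x + k * g v = (\<Sum>s\<in>S. c s * F s x) + k * (\<Sum>s\<in>S. c s * F s v)"
        using insert.prems(4)[of x "scale k v"] insert.prems(5)[of v k] x v kv by simp
      then have "g x = (\<Sum>s\<in>S. c s * F s x) - k * (g v - (\<Sum>s\<in>S. c s * F s v))"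
        by (simp add: algebra_simps)
      also have "- k * (g v - (\<Sum>s\<in>S. c s * F s v)) = d * F a x"
        by (simp add: k_def d_def)
      then have "(\<Sum>s\<in>S. c s * F s x) - k * (g v - (\<Sum>s\<in>S. c s * F s v))
          = (\<Sum>s\<in>S. c s * F s x) + d * F a x"
        by simp
      finally have "g x = d * F a x + (\<Sum>s\<in>S. c s * F s x)" by (simp add: add.commute)
      moreover have "(\<Sum>s\<in>S. (c(a := d)) s * F s x) = (\<Sum>s\<in>S. c s * F s x)"
        using insert.hyps by (intro sum.cong) auto
      ultimately show ?thesis
        using insert.hyps by simp
    qed
    then show ?thesis by blast
  qed
qed

text \<open>Applying \<open>T\<close> minus the scalar \<open>a\<close> to the sum stays in
  \<open>W\<close>, removes the component for \<open>a\<close> and multiplies each other one by the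
  nonzero number \<open>c - a\<close>. Components are indexed by their eigenvalues, so distinct
  indices carry distinct eigenvalues.\<close>

lemma (in vector_space) eigen_components_in_invariant_subspace:
  assumes "finite C" "subspace W"
    and add: "\<And>x y. T (x + y) = T x + T y"
    and hom: "\<And>c x. T (scale c x) = scale c (T x)"
    and inv: "\<And>x. x \<in> W \<Longrightarrow> T x \<in> W"
    and "\<And>c. c \<in> C \<Longrightarrow> T (u c) = scale c (u c)"
    and "(\<Sum>c\<in>C. u c) \<in> W"
  shows "\<forall>c\<in>C. u c \<in> W"
  using assms(1,6,7)
proof (induction C arbitrary: u rule: finite_induct)
  case empty
  then show ?case by simp
next
  case (insert a C)
  have T0: "T 0 = 0" using add[of 0 0] by simp
  have Tsum: "T (\<Sum>c\<in>A. u c) = (\<Sum>c\<in>A. T (u c))" for A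
    by (induction A rule: infinite_finite_induct) (auto simp: T0 add)
  let ?x = "\<Sum>c\<in>insert a C. u c"
  have "T ?x - scale a ?x = (\<Sum>c\<in>insert a C. scale (c - a) (u c))"
    unfolding Tsum scale_sum_right sum_subtractf[symmetric]
    using insert.prems(1) by (intro sum.cong) (auto simp: scale_left_diff_distrib)
  also have "\<dots> = (\<Sum>c\<in>C. scale (c - a) (u c))"
    using insert.hyps by simp
  finally have "(\<Sum>c\<in>C. scale (c - a) (u c)) = T ?x - scale a ?x" ..
  then have "(\<Sum>c\<in>C. scale (c - a) (u c)) \<in> W"
    using subspace_diff[OF assms(2) inv[OF insert.prems(2)] subspace_scale[OF assms(2) insert.prems(2)]]
    by simp
  moreover have "T (scale (c - a) (u c)) = scale c (scale (c - a) (u c))" if "c \<in> C" for c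
    using insert.prems(1)[of c] that by (simp add: hom scale_left_commute)
  ultimately have "\<forall>c\<in>C. scale (c - a) (u c) \<in> W"
    by (intro insert.IH) auto
  then have "\<forall>c\<in>C. scale (1 / (c - a)) (scale (c - a) (u c)) \<in> W"
    using assms(2) subspace_scale by blast
  moreover have "scale (1 / (c - a)) (scale (c - a) (u c)) = u c" if "c \<in> C" for c
    using insert.hyps that by auto
  ultimately have C: "\<forall>c\<in>C. u c \<in> W"
    by metis
  then have "(\<Sum>c\<in>C. u c) \<in> W" using assms(2) by (auto intro: subspace_sum)
  then have "?x - (\<Sum>c\<in>C. u c) \<in> W"
    using assms(2) insert.prems(2) by (intro subspace_diff)
  then show ?case using C insert.hyps by simp
qed

section \<open>Bracket, trace and Killing form\<close>

context fd_lie_algebra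
begin

lemma br_add_right: "br x (y + z) = br x y + br x z"
proof -
  interpret Vector_Spaces.linear scale scale "br x" by (rule linear_right)
  show ?thesis by (rule add)
qed

lemma br_scale_right: "br x (scale c y) = scale c (br x y)"
proof -
  interpret Vector_Spaces.linear scale scale "br x" by (rule linear_right)
  show ?thesis by (rule scale)
qed

lemma br_add_left: "br (x + y) z = br x z + br y z"
proof -
  interpret Vector_Spaces.linear scale scale "\<lambda>x. br x z" by (rule linear_left)
  show ?thesis by (rule add)
qed

lemma br_scale_left: "br (scale c x) y = scale c (br x y)"
proof -
  interpret Vector_Spaces.linear scale scale "\<lambda>x. br x y" by (rule linear_left)
  show ?thesis by (rule scale)
qed

lemma br_0_right [simp]: "br x 0 = 0"
  using br_scale_right[of x 0 0] by simp

lemma br_0_left [simp]: "br 0 x = 0"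
  using br_scale_left[of 0 0 x] by simp

lemma br_minus_right: "br x (- y) = - br x y"
  using br_scale_right[of x "- 1" y] by simp

lemma br_sum_right: "br x (\<Sum>a\<in>A. u a) = (\<Sum>a\<in>A. br x (u a))"
  by (induction A rule: infinite_finite_induct) (auto simp: br_add_right)

lemma br_anticommute: "br x y = - br y x"
proof -
  have "br (x + y) (x + y) = 0" by (rule alternating)
  then have "br y x + br x y = 0"
    unfolding br_add_left br_add_right by (simp add: alternating)
  then show ?thesis by (simp add: eq_neg_iff_add_eq_0 add.commute)
qed

lemma br_br: "br (br x y) z = br x (br y z) - br y (br x z)"
proof -
  have "br x (br y z) + br y (br z x) + br z (br x y) = 0" by (rule jacobi)
  moreover have "br y (br z x) = - br y (br x z)"
    by (metis br_anticommute br_minus_right)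
  moreover have "br z (br x y) = - br (br x y) z" by (rule br_anticommute)
  ultimately show ?thesis by (simp add: algebra_simps)
qed

text \<open>Since ad \<open>h\<close> is a derivation, eigenvalues add. With opposite eigenvalues
  the bracket commutes with \<open>h\<close>.\<close>

lemma br_diagonal:
  assumes "br h x = scale a x" "br h y = scale b y"
  shows "br h (br x y) = scale (a + b) (br x y)"
proof -
  have "br h (br x y) = br (br h x) y + br x (br h y)"
    using br_br[of h x y] by simp
  then show ?thesis
    using assms by (simp add: br_scale_left br_scale_right scale_left_distrib)
qed

lemma br_right_module_hom: "module_hom scale scale (br x)"
  using linear_right by (simp add: Vector_Spaces.linear_def)

lemma representation_sum_scale:
  "representation Basis (\<Sum>i\<in>A. scale (c i) (v i)) b = (\<Sum>i\<in>A. c i * representation Basis (v i) b)"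
  by (simp add: representation_sum representation_scale independent_Basis span_Basis)

text \<open>Expanding in the basis turns each trace into the same double sum of products of matrix
  entries, summed in opposite orders.\<close>

lemma trace_comp_commute:
  assumes "module_hom scale scale S" "module_hom scale scale T"
  shows "trace (\<lambda>x. S (T x)) = trace (\<lambda>x. T (S x))"
proof -
  have expand: "trace (\<lambda>x. S (T x)) =
      (\<Sum>b\<in>Basis. \<Sum>d\<in>Basis. representation Basis (T b) d * representation Basis (S d) b)"
    if S: "module_hom scale scale S" for S T
  proof -
    interpret module_hom scale scale S by (rule S)
    have "S (T b) = (\<Sum>d\<in>Basis. scale (representation Basis (T b) d) (S d))" for b
    proof -
      have "T b = (\<Sum>d\<in>Basis. scale (representation Basis (T b) d) d)"
        by (simp add: sum_representation_eq independent_Basis span_Basis finite_Basis)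
      then have "S (T b) = S (\<Sum>d\<in>Basis. scale (representation Basis (T b) d) d)" by simp
      then show ?thesis by (simp add: sum scale)
    qed
    then show ?thesis by (simp add: trace_def representation_sum_scale)
  qed
  have "trace (\<lambda>x. S (T x)) =
      (\<Sum>d\<in>Basis. \<Sum>b\<in>Basis. representation Basis (T b) d * representation Basis (S d) b)"
    unfolding expand[OF assms(1)] by (rule sum.swap)
  also have "\<dots> = trace (\<lambda>x. T (S x))"
    unfolding expand[OF assms(2)] by (simp add: mult.commute)
  finally show ?thesis .
qed

lemma trace_add: "trace (\<lambda>x. S x + T x) = trace S + trace T"
  by (simp add: trace_def representation_add independent_Basis span_Basis sum.distrib)

lemma trace_diff: "trace (\<lambda>x. S x - T x) = trace S - trace T"
  by (simp add: trace_def representation_diff independent_Basis span_Basis sum_subtractf)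

lemma trace_scale: "trace (\<lambda>x. scale c (T x)) = c * trace T"
  by (simp add: trace_def representation_scale independent_Basis span_Basis sum_distrib_left)

lemma killing_commute: "killing x y = killing y x"
  unfolding killing_def by (intro trace_comp_commute br_right_module_hom)

lemma killing_add_left: "killing (x + y) z = killing x z + killing y z"
  by (simp add: killing_def br_add_left trace_add)

lemma killing_scale_left: "killing (scale c x) y = c * killing x y"
  by (simp add: killing_def br_scale_left trace_scale)

lemma killing_diff_left: "killing (x - y) z = killing x z - killing y z"
  using killing_add_left[of "x - y" y z] by simp

lemma killing_add_right: "killing x (y + z) = killing x y + killing x z"
  by (metis killing_commute killing_add_left)

lemma killing_scale_right: "killing x (scale c y) = c * killing x y"
  by (metis killing_commute killing_scale_left)

lemma killing_0_left [simp]: "killing 0 x = 0"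
  using killing_scale_left[of 0 0 x] by simp

lemma killing_0_right [simp]: "killing x 0 = 0"
  using killing_scale_right[of x 0 0] by simp

lemma killing_sum_left: "killing (\<Sum>a\<in>A. u a) y = (\<Sum>a\<in>A. killing (u a) y)"
  by (induction A rule: infinite_finite_induct) (auto simp: killing_add_left)

lemma killing_sum_right: "killing x (\<Sum>a\<in>A. u a) = (\<Sum>a\<in>A. killing x (u a))"
  by (induction A rule: infinite_finite_induct) (auto simp: killing_add_right)

text \<open>With ad of a bracket written as a commutator, both sides become differences of traces of
  triple products, which agree after one cyclic rotation.\<close>

lemma killing_invariant: "killing (br x y) z = killing x (br y z)"
proof -
  have hom: "module_hom scale scale (\<lambda>v. br x (br z v))"
    using module_hom_compose[OF br_right_module_hom br_right_module_hom] by (simp add: o_def)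
  have "killing (br x y) z = trace (\<lambda>v. br x (br y (br z v))) - trace (\<lambda>v. br y (br x (br z v)))"
    unfolding killing_def br_br trace_diff ..
  also have "trace (\<lambda>v. br y (br x (br z v))) = trace (\<lambda>v. br x (br z (br y v)))"
    by (rule trace_comp_commute[OF br_right_module_hom hom])
  also have "trace (\<lambda>v. br x (br y (br z v))) - trace (\<lambda>v. br x (br z (br y v))) = killing x (br y z)"
  proof -
    have "br x (br (br y z) v) = br x (br y (br z v)) - br x (br z (br y v))" for v
      using br_add_right[of x "br y (br z v) - br z (br y v)" "br z (br y v)"]
      by (simp add: br_br)
    then show ?thesis unfolding killing_def by (simp add: trace_diff)
  qed
  finally show ?thesis .
qed

text \<open>Invariance moves the bracket into the other argument, where an element of the radical
  pairs to 0 with everything.\<close>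

lemma ideal_killing_radical: "ideal {x. \<forall>y. killing x y = 0}"
  unfolding ideal_def
proof (intro conjI allI ballI)
  show "subspace {x. \<forall>y. killing x y = 0}"
    by (rule subspaceI) (simp_all add: killing_add_left killing_scale_left)
next
  fix x y
  assume "y \<in> {x. \<forall>y. killing x y = 0}"
  then have "killing (br y x) z = 0" for z
    by (simp add: killing_invariant)
  then have "killing (scale (- 1) (br y x)) z = 0" for z
    unfolding killing_scale_left by simp
  moreover have "scale (- 1) (br y x) = br x y"
    using br_anticommute[of x y] by simp
  ultimately show "br x y \<in> {x. \<forall>y. killing x y = 0}" by simp
qed

lemma subspace_centralizer: "subspace {x. \<forall>k\<in>F. br k x = 0}"
  by (rule subspaceI) (simp_all add: br_add_right br_scale_right)

text \<open>Grouping a combination of eigenvectors by eigenvalue leaves one component per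
  eigenvalue, the form that \<open>eigen_components_in_invariant_subspace\<close> takes.\<close>

lemma eigen_decomposition:
  assumes "span {x. \<exists>c. br h x = scale c x} = UNIV"
  shows "\<exists>C u. finite C \<and> (\<forall>c\<in>C. br h (u c) = scale c (u c)) \<and> x = (\<Sum>c\<in>C. u c)"
proof -
  have "x \<in> span {x. \<exists>c. br h x = scale c x}" using assms by simp
  then obtain t a where t: "finite t" "t \<subseteq> {x. \<exists>c. br h x = scale c x}"
    and x: "x = (\<Sum>v\<in>t. scale (a v) v)"
    by (auto simp: span_explicit)
  from t(2) have "\<forall>v\<in>t. \<exists>c. br h v = scale c v" by blast
  then obtain g where g: "\<And>v. v \<in> t \<Longrightarrow> br h v = scale (g v) v" by metis
  define u where "u c = (\<Sum>v\<in>{v \<in> t. g v = c}. scale (a v) v)" for c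
  have "br h (u c) = scale c (u c)" for c
    unfolding u_def br_sum_right scale_sum_right
    by (intro sum.cong) (auto simp: br_scale_right g scale_left_commute)
  moreover have "x = (\<Sum>c\<in>g ` t. u c)"
    unfolding x u_def by (rule sum.image_gen[OF t(1)])
  ultimately show ?thesis using finite_imageI[OF t(1)] by blast
qed

section \<open>Cartan subalgebras: orthogonality and finiteness of the roots\<close>

lemma cartan_subspace: "cartan_subalgebra H \<Longrightarrow> subspace H"
  and cartan_commute: "cartan_subalgebra H \<Longrightarrow> x \<in> H \<Longrightarrow> y \<in> H \<Longrightarrow> br x y = 0"
  and cartan_self_centralizing:
    "cartan_subalgebra H \<Longrightarrow> (\<And>h. h \<in> H \<Longrightarrow> br h x = 0) \<Longrightarrow> x \<in> H"
  unfolding cartan_subalgebra_def by blast+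

text \<open>
  Induction on the generators of \<open>H\<close>, dropping one centralizer condition at a time, replaces the
  root space decomposition: the eigenvectors of \<open>ad k\<close> with nonzero eigenvalue are orthogonal to \<open>h\<close>.
\<close>

lemma cartan_orthogonal_of_spanning:
  assumes H: "cartan_subalgebra H" and h: "h \<in> H" "\<And>k. k \<in> H \<Longrightarrow> killing h k = 0"
    and F: "finite F" "F \<subseteq> H" "H \<subseteq> span F"
  shows "killing h x = 0"
proof -
  \<comment> \<open>The generators in \<open>F - G\<close> must still commute with \<open>x\<close>:
    \<open>G = {}\<close> forces \<open>x\<close> into \<open>H\<close>, while \<open>G = F\<close>
    leaves \<open>x\<close> arbitrary.\<close>
  have *: "\<forall>x. (\<forall>k\<in>F - G. br k x = 0) \<longrightarrow> killing h x = 0" if "finite G" "G \<subseteq> F" for G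
    using that
  proof (induction G rule: finite_induct)
    case empty
    show ?case
    proof (intro allI impI)
      fix x assume x: "\<forall>k\<in>F - {}. br k x = 0"
      have "br k x = 0" if "k \<in> H" for k
      proof -
        have "k \<in> span F" using F that by blast
        then show ?thesis
        proof (induction rule: span_induct)
          case base
          show ?case by (rule subspaceI) (simp_all add: br_add_left br_scale_left)
        next
          case (step k)
          then show ?case using x by simp
        qed
      qed
      then show "killing h x = 0" using cartan_self_centralizing[OF H] h by blast
    qed
  next
    case (insert k G)
    show ?case
    proof (intro allI impI)
      fix x assume x: "\<forall>j\<in>F - insert k G. br j x = 0"
      have k: "k \<in> H" using insert.prems F by blast
      have "span {x. \<exists>c. br k x = scale c x} = UNIV"
        using H k by (simp add: cartan_subalgebra_def)
      then obtain C u where C: "finite C" "\<And>c. c \<in> C \<Longrightarrow> br k (u c) = scale c (u c)"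
        and x_eq: "x = (\<Sum>c\<in>C. u c)"
        using eigen_decomposition[of k x] by blast
      let ?W = "{x. \<forall>j\<in>F - insert k G. br j x = 0}"
      \<comment> \<open>Commutativity of \<open>H\<close> makes \<open>?W\<close> invariant under ad
        \<open>k\<close>, so the eigencomponents of \<open>x\<close> stay in it.\<close>
      have "br k y \<in> ?W" if "y \<in> ?W" for y
      proof -
        have "br j (br k y) = 0" if j: "j \<in> F - insert k G" for j
        proof -
          have "br j k = 0" using cartan_commute[OF H] j k F by blast
          then show ?thesis using br_br[of j k y] j \<open>y \<in> ?W\<close> by simp
        qed
        then show ?thesis by simp
      qed
      then have uW: "\<forall>c\<in>C. u c \<in> ?W"
        using C x x_eq
        by (intro eigen_components_in_invariant_subspace[of C ?W "br k" u])
          (auto simp: subspace_centralizer br_add_right br_scale_right)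
      have "killing h (u c) = 0" if c: "c \<in> C" for c
      proof (cases "c = 0")
        case True
        \<comment> \<open>A component of eigenvalue 0 also commutes with \<open>k\<close>, so it
          meets the stronger condition of the induction hypothesis.\<close>
        then have "\<forall>j\<in>F - G. br j (u c) = 0" using uW c C(2)[OF c] by auto
        then show ?thesis using insert by blast
      next
        case False
        have "c * killing h (u c) = killing h (br k (u c))"
          using C(2)[OF c] by (simp add: killing_scale_right)
        also have "\<dots> = 0"
          using cartan_commute[OF H h(1) k] by (simp flip: killing_invariant)
        finally show ?thesis using False by simp
      qed
      then show "killing h x = 0" unfolding x_eq killing_sum_right by simp
    qed
  qed
  show ?thesis using *[of F] F(1) by simp
qed

text \<open>A basis of \<open>H\<close> is a finite generating set. The result carries nondegeneracy
  of the Killing form over to \<open>H\<close>: an element of \<open>H\<close> orthogonal to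
  \<open>H\<close> lies in the radical.\<close>

lemma cartan_orthogonal:
  assumes "cartan_subalgebra H" "h \<in> H" "\<And>k. k \<in> H \<Longrightarrow> killing h k = 0"
  shows "killing h x = 0"
proof -
  obtain F where "F \<subseteq> H" "independent F" "H \<subseteq> span F"
    by (metis basis_exists)
  then show ?thesis
    using cartan_orthogonal_of_spanning[OF assms] finiteI_independent by blast
qed

text \<open>Two distinct weights differ at some \<open>h\<close> in \<open>H\<close>. Applying ad
  \<open>h\<close> minus the scalar \<open>\<gamma> h\<close> removes the \<open>\<gamma>\<close>
  term and only rescales the others, so the induction hypothesis applies.\<close>

lemma weight_vectors_sum_0:
  assumes "finite S" "S \<subseteq> dual H"
    and "\<And>\<beta>. \<beta> \<in> S \<Longrightarrow> u \<beta> \<in> weight_space H UNIV \<beta>"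
    and "(\<Sum>\<beta>\<in>S. u \<beta>) = 0"
  shows "\<forall>\<beta>\<in>S. u \<beta> = 0"
  using assms
proof (induction S arbitrary: u rule: finite_induct)
  case empty
  then show ?case by simp
next
  case (insert \<gamma> S)
  have u: "br h (u \<beta>) = scale (\<beta> h) (u \<beta>)" if "h \<in> H" "\<beta> \<in> insert \<gamma> S" for h \<beta>
    using insert.prems(2)[OF that(2)] that(1) by (simp add: weight_space_def)
  have S: "u \<beta> = 0" if \<beta>: "\<beta> \<in> S" for \<beta>
  proof -
    have \<beta>\<gamma>: "\<beta> \<in> dual H" "\<gamma> \<in> dual H" "\<beta> \<noteq> \<gamma>"
      using insert.prems(1) insert.hyps(2) \<beta> by auto
    then obtain h where h: "\<beta> h \<noteq> \<gamma> h" by (auto simp: fun_eq_iff)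
    \<comment> \<open>Functionals in \<open>dual H\<close> vanish off \<open>H\<close>, so they can
      differ only on \<open>H\<close>.\<close>
    have hH: "h \<in> H"
    proof (rule ccontr)
      assume "h \<notin> H"
      then have "\<beta> h = 0" "\<gamma> h = 0" using \<beta>\<gamma> by (auto simp: dual_def)
      then show False using h by simp
    qed
    let ?v = "\<lambda>\<delta>. scale (\<delta> h - \<gamma> h) (u \<delta>)"
    have "0 = br h (\<Sum>\<delta>\<in>insert \<gamma> S. u \<delta>) - scale (\<gamma> h) (\<Sum>\<delta>\<in>insert \<gamma> S. u \<delta>)"
      using insert.prems by simp
    also have "\<dots> = (\<Sum>\<delta>\<in>insert \<gamma> S. ?v \<delta>)"
      unfolding br_sum_right scale_sum_right sum_subtractf[symmetric]
      using u hH by (intro sum.cong) (auto simp: scale_left_diff_distrib)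
    also have "\<dots> = (\<Sum>\<delta>\<in>S. ?v \<delta>)" using insert.hyps by simp
    finally have "(\<Sum>\<delta>\<in>S. ?v \<delta>) = 0" by simp
    moreover have "?v \<delta> \<in> weight_space H UNIV \<delta>" if "\<delta> \<in> S" for \<delta>
      using u that by (simp add: weight_space_def br_scale_right scale_left_commute)
    ultimately have "?v \<beta> = 0" using insert.IH[of ?v] insert.prems \<beta> by blast
    then show ?thesis using h by simp
  qed
  then show ?case using insert by simp
qed

text \<open>One nonzero weight vector per root gives an independent family, and finite dimension
  bounds its size.\<close>

lemma finite_roots: "finite (roots H UNIV)"
proof -
  have "\<forall>\<beta>\<in>roots H UNIV. \<exists>x. x \<noteq> 0 \<and> x \<in> weight_space H UNIV \<beta>"
  proof
    fix \<beta> assume "\<beta> \<in> roots H UNIV"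
    moreover have "0 \<in> weight_space H UNIV \<beta>" by (simp add: weight_space_def)
    ultimately show "\<exists>x. x \<noteq> 0 \<and> x \<in> weight_space H UNIV \<beta>"
      by (auto simp: roots_def)
  qed
  then obtain v where v: "\<And>\<beta>. \<beta> \<in> roots H UNIV \<Longrightarrow> v \<beta> \<noteq> 0"
      "\<And>\<beta>. \<beta> \<in> roots H UNIV \<Longrightarrow> v \<beta> \<in> weight_space H UNIV \<beta>"
    by metis
  have dual: "\<beta> \<in> dual H" if "\<beta> \<in> roots H UNIV" for \<beta>
    using that by (simp add: roots_def)
  have inj: "inj_on v (roots H UNIV)"
  proof (rule inj_onI, rule ccontr)
    fix \<beta> \<gamma> assume *: "\<beta> \<in> roots H UNIV" "\<gamma> \<in> roots H UNIV" "v \<beta> = v \<gamma>" "\<beta> \<noteq> \<gamma>"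
    \<comment> \<open>If two roots shared a vector, it and its negative would be weight vectors for
      distinct weights with sum 0.\<close>
    have "- v \<gamma> \<in> weight_space H UNIV \<gamma>"
      using v(2)[OF *(2)] by (simp add: weight_space_def br_minus_right)
    then have "\<forall>\<delta>\<in>{\<beta>, \<gamma>}. (v(\<gamma> := - v \<gamma>)) \<delta> = 0"
      using * v dual by (intro weight_vectors_sum_0[of _ H]) auto
    then show False using * v by auto
  qed
  have "independent (v ` roots H UNIV)"
    unfolding independent_explicit_module
  proof (intro allI impI)
    fix t a x
    assume t: "finite t" "t \<subseteq> v ` roots H UNIV" and 0: "(\<Sum>x\<in>t. scale (a x) x) = 0" and x: "x \<in> t"
    obtain S where S: "S \<subseteq> roots H UNIV" "t = v ` S" using t(2) by (auto simp: subset_image_iff)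
    have injS: "inj_on v S" using inj S(1) inj_on_subset by blast
    have "(\<Sum>\<beta>\<in>S. scale (a (v \<beta>)) (v \<beta>)) = 0"
      using 0 injS by (simp add: S(2) sum.reindex)
    moreover have "scale (a (v \<beta>)) (v \<beta>) \<in> weight_space H UNIV \<beta>" if "\<beta> \<in> S" for \<beta>
      using v(2)[of \<beta>] S(1) that
      by (auto simp: weight_space_def br_scale_right scale_left_commute)
    moreover have "finite S" using t(1) S(2) injS finite_imageD by blast
    ultimately have "\<forall>\<beta>\<in>S. scale (a (v \<beta>)) (v \<beta>) = 0"
      using S(1) dual by (intro weight_vectors_sum_0[of S H]) auto
    then show "a x = 0" using x S v by auto
  qed
  then have "finite (v ` roots H UNIV)" by (rule finiteI_independent)
  then show ?thesis using inj finite_imageD by blast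
qed

end

section \<open>Positive and simple roots\<close>

context simple_lie_algebra_with_roots
begin

lemma finite_pos_roots: "finite pos_roots"
  by (rule finite_subset[OF _ finite_roots]) (auto simp: pos_roots_def)

lemma simple_root_pos:
  assumes "s \<in> {1..r}"
  shows "\<alpha>s s \<in> pos_roots"
proof -
  have "\<alpha>s s h = (\<Sum>j=1..r. of_nat (if j = s then 1 else 0) * \<alpha>s j h)" for h
  proof -
    have "(\<Sum>j=1..r. of_nat (if j = s then 1 else 0) * \<alpha>s j h) = (\<Sum>j=1..r. if j = s then \<alpha>s j h else 0)"
      by (intro sum.cong) auto
    then show ?thesis using assms by (simp add: sum.delta)
  qed
  moreover have "\<alpha>s s \<in> roots H UNIV"
    using simple assms unfolding simple_roots_def by blast
  ultimately show ?thesis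
    unfolding pos_roots_def by (intro CollectI conjI exI[of _ "\<lambda>j. if j = s then 1 else 0"]) auto
qed

lemma simple_roots_independent:
  assumes "\<And>h. (\<Sum>s=1..r. c s * \<alpha>s s h) = 0" "s \<in> {1..r}"
  shows "c s = 0"
  using simple assms unfolding simple_roots_def by blast

lemma simple_roots_span:
  assumes "\<mu> \<in> dual H"
  obtains c where "\<And>h. \<mu> h = (\<Sum>s=1..r. c s * \<alpha>s s h)"
  using simple assms unfolding simple_roots_def by meson

lemma pos_root_dual: "\<beta> \<in> pos_roots \<Longrightarrow> \<beta> \<in> dual H"
  by (simp add: pos_roots_def roots_def)

end

section \<open>Root vectors and Killing duals of positive roots\<close>

context levi_setting
begin

lemma br_e: "\<beta> \<in> pos_roots \<Longrightarrow> h \<in> H \<Longrightarrow> br h (e \<beta>) = scale (\<beta> h) (e \<beta>)"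
  using e_in by (simp add: weight_space_def)

lemma br_f: "\<beta> \<in> pos_roots \<Longrightarrow> h \<in> H \<Longrightarrow> br h (f \<beta>) = scale (- \<beta> h) (f \<beta>)"
  using f_in by (simp add: weight_space_def)

lemma e_nonzero: "\<beta> \<in> pos_roots \<Longrightarrow> e \<beta> \<noteq> 0"
  using ef_normalized by fastforce

lemma f_nonzero: "\<beta> \<in> pos_roots \<Longrightarrow> f \<beta> \<noteq> 0"
  using ef_normalized by fastforce

lemma neg_pos_root:
  assumes "\<beta> \<in> pos_roots"
  shows "- \<beta> \<in> roots H UNIV"
proof -
  have "- \<beta> \<in> dual H"
    using pos_root_dual[OF assms] by (simp add: dual_def)
  moreover have "- \<beta> \<noteq> 0"
    using assms by (simp add: pos_roots_def roots_def)
  ultimately show ?thesis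
    using f_in[OF assms] f_nonzero[OF assms] by (auto simp: roots_def)
qed

text \<open>The vectors \<open>e \<beta>\<close> and \<open>f \<beta>\<close> pair to 1, so the
  radical is not the whole algebra; by simplicity it is zero.\<close>

lemma killing_nondegenerate:
  assumes "\<beta> \<in> pos_roots" "\<And>y. killing x y = 0"
  shows "x = 0"
proof -
  have "e \<beta> \<notin> {x. \<forall>y. killing x y = 0}"
    using ef_normalized[OF assms(1)] by (auto intro: exI[of _ "f \<beta>"])
  then have "{x. \<forall>y. killing x y = 0} = {0}"
    using no_proper_ideal[OF ideal_killing_radical] by blast
  then show ?thesis using assms(2) by blast
qed

text \<open>The bracket of \<open>e \<beta>\<close> and \<open>f \<beta>\<close> has weight 0, hence
  lies in the self-centralizing \<open>H\<close>; invariance and the normalization make it represent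
  \<open>\<beta>\<close>. Nondegeneracy on \<open>H\<close> gives the uniqueness behind the definite
  description.\<close>

lemma killing_dual:
  assumes \<beta>: "\<beta> \<in> pos_roots"
  shows killing_dual_eq: "killing_dual \<beta> = br (e \<beta>) (f \<beta>)"
    and killing_dual_in: "killing_dual \<beta> \<in> H"
    and killing_killing_dual: "h \<in> H \<Longrightarrow> killing (killing_dual \<beta>) h = \<beta> h"
proof -
  let ?t = "br (e \<beta>) (f \<beta>)"
  have tH: "?t \<in> H"
  proof (rule cartan_self_centralizing[OF cartan])
    fix h assume "h \<in> H"
    then show "br h ?t = 0"
      using br_diagonal[OF br_e[OF \<beta>] br_f[OF \<beta>]] by simp
  qed
  have t: "killing ?t h = \<beta> h" if "h \<in> H" for h
  proof -
    have "killing ?t h = killing (e \<beta>) (br (f \<beta>) h)" by (rule killing_invariant)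
    also have "br (f \<beta>) h = scale (\<beta> h) (f \<beta>)"
      using br_anticommute[of "f \<beta>" h] br_f[OF \<beta> that] by simp
    finally show ?thesis using ef_normalized[OF \<beta>] by (simp add: killing_scale_right)
  qed
  have unique: "u = ?t" if u: "u \<in> H" "\<forall>h\<in>H. killing u h = \<beta> h" for u
  proof -
    have "u - ?t \<in> H" using u tH cartan_subspace[OF cartan] by (simp add: subspace_diff)
    moreover have "killing (u - ?t) h = 0" if "h \<in> H" for h
      using u t that by (simp add: killing_diff_left)
    ultimately have "killing (u - ?t) y = 0" for y
      by (rule cartan_orthogonal[OF cartan])
    then have "u - ?t = 0" by (rule killing_nondegenerate[OF \<beta>])
    then show ?thesis by simp
  qed
  show *: "killing_dual \<beta> = ?t"
    unfolding killing_dual_def using tH t unique by (intro the_equality) blast+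
  show "killing_dual \<beta> \<in> H" using * tH by simp
  show "h \<in> H \<Longrightarrow> killing (killing_dual \<beta>) h = \<beta> h" using * t by simp
qed

section \<open>The Levi subalgebra, its center and its characters\<close>

lemma H_subset_L: "H \<subseteq> L"
  unfolding L_levi levi_def by (rule order_trans[OF Un_upper1 span_superset])

lemma subspace_L: "subspace L"
  unfolding L_levi levi_def by (rule subspace_span)

lemma weight_space_subset_L:
  assumes "\<beta> \<in> roots H UNIV" "\<And>h. \<beta> h = (\<Sum>s\<in>I. of_int (m s) * \<alpha>s s h)"
  shows "weight_space H UNIV \<beta> \<subseteq> L"
proof
  fix x assume "x \<in> weight_space H UNIV \<beta>"
  moreover have "\<exists>m. \<forall>h. \<beta> h = (\<Sum>s\<in>I. of_int (m s) * \<alpha>s s h)"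
    using assms(2) by blast
  ultimately show "x \<in> L"
    unfolding L_levi levi_def using assms(1) by (intro span_base) blast
qed

lemma finite_I: "finite I"
  using I_subset finite_subset by blast

lemma simple_root_vectors_in_L:
  assumes "s \<in> I"
  shows "e (\<alpha>s s) \<in> L" "f (\<alpha>s s) \<in> L"
proof -
  have pos: "\<alpha>s s \<in> pos_roots" using simple_root_pos assms I_subset by blast
  \<comment> \<open>The values \<open>k = 1\<close> and \<open>k = - 1\<close> exhibit the simple
    root and its negative as integral combinations over \<open>I\<close>.\<close>
  have delta: "(\<Sum>j\<in>I. of_int (if j = s then k else 0) * \<alpha>s j h) = of_int k * \<alpha>s s h" for h k
  proof -
    have "(\<Sum>j\<in>I. of_int (if j = s then k else 0) * \<alpha>s j h)
        = (\<Sum>j\<in>I. if j = s then of_int k * \<alpha>s j h else 0)"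
      by (intro sum.cong) auto
    then show ?thesis using assms finite_I by (simp add: sum.delta)
  qed
  have "\<alpha>s s \<in> roots H UNIV" using pos by (simp add: pos_roots_def)
  then have "weight_space H UNIV (\<alpha>s s) \<subseteq> L"
    by (rule weight_space_subset_L[where m = "\<lambda>j. if j = s then 1 else 0"]) (subst delta, simp)
  then show "e (\<alpha>s s) \<in> L" using e_in[OF pos] by blast
  have "weight_space H UNIV (- \<alpha>s s) \<subseteq> L"
    using neg_pos_root[OF pos]
    by (rule weight_space_subset_L[where m = "\<lambda>j. if j = s then - 1 else 0"]) (subst delta, simp)
  then show "f (\<alpha>s s) \<in> L" using f_in[OF pos] by blast
qed

text \<open>The roots generating \<open>L\<close> are integral combinations of the simple roots in
  \<open>I\<close>, so they all vanish at \<open>x\<close>, and \<open>x\<close> commutes with every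
  generator.\<close>

lemma in_center_L:
  assumes x: "x \<in> H" "\<And>s. s \<in> I \<Longrightarrow> \<alpha>s s x = 0"
  shows "x \<in> center L"
proof -
  have "br x y = 0" if "y \<in> L" for y
    using that unfolding L_levi levi_def
  proof (induction y rule: span_induct)
    case base
    show ?case by (rule subspaceI) (simp_all add: br_add_right br_scale_right)
  next
    case (step y)
    then consider "y \<in> H" | \<beta> m where "y \<in> weight_space H UNIV \<beta>"
        "\<forall>h. \<beta> h = (\<Sum>s\<in>I. of_int (m s) * \<alpha>s s h)"
      by blast
    then show ?case
    proof cases
      case 1
      then show ?thesis using cartan_commute[OF cartan] x by blast
    next
      case 2
      then have "\<beta> x = 0" using x(2) by simp
      then show ?thesis using 2(1) x(1) by (simp add: weight_space_def)
    qed
  qed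
  then show ?thesis using x(1) H_subset_L by (auto simp: center_def)
qed

lemma center_L_subset_H: "center L \<subseteq> H"
proof
  fix z assume z: "z \<in> center L"
  show "z \<in> H"
  proof (rule cartan_self_centralizing[OF cartan])
    fix h assume "h \<in> H"
    then have "br z h = 0" using z H_subset_L by (auto simp: center_def)
    then show "br h z = 0" using br_anticommute[of h z] by simp
  qed
qed

text \<open>The nonzero vector \<open>e (\<alpha>s s)\<close> of \<open>L\<close> has eigenvalue
  \<open>\<alpha>s s z\<close> under ad \<open>z\<close>, and \<open>z\<close> is central. With the
  two preceding lemmas, \<open>center L\<close> is the common kernel in \<open>H\<close> of the
  simple roots in \<open>I\<close>.\<close>

lemma simple_root_center_L:
  assumes "s \<in> I" "z \<in> center L"
  shows "\<alpha>s s z = 0"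
proof -
  have pos: "\<alpha>s s \<in> pos_roots" using simple_root_pos assms I_subset by blast
  have "br z (e (\<alpha>s s)) = 0"
    using assms simple_root_vectors_in_L by (simp add: center_def)
  moreover have "z \<in> H" using assms center_L_subset_H by blast
  ultimately show ?thesis using br_e[OF pos] e_nonzero[OF pos] by simp
qed

lemma levi_root_center_L:
  assumes "\<beta> \<in> roots H L" "z \<in> center L"
  shows "\<beta> z = 0"
proof -
  have "0 \<in> weight_space H L \<beta>"
    using subspace_0[OF subspace_L] by (simp add: weight_space_def)
  then obtain x where x: "x \<in> weight_space H L \<beta>" "x \<noteq> 0"
    using assms(1) by (auto simp: roots_def)
  have "z \<in> H" using assms center_L_subset_H by blast
  then have "br z x = scale (\<beta> z) x" using x(1) by (simp add: weight_space_def)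
  moreover have "br z x = 0" using assms(2) x(1) by (simp add: center_def weight_space_def)
  ultimately show ?thesis using x(2) by simp
qed

text \<open>The expansion of \<open>\<xi>\<close> on \<open>H\<close> in simple roots gives
  \<open>t\<close> as the same combination of their Killing duals. Centrality of \<open>t\<close>
  comes from the vanishing of \<open>\<xi>\<close> on brackets.\<close>

lemma character_representative:
  assumes "character \<xi>"
  obtains t where "t \<in> center L" "\<And>\<beta>. \<beta> \<in> pos_roots \<Longrightarrow> form \<xi> \<beta> = \<beta> t"
proof -
  have \<xi>: "\<xi> \<in> dual L" "\<And>x y. x \<in> L \<Longrightarrow> y \<in> L \<Longrightarrow> \<xi> (br x y) = 0"
    using assms by (auto simp: character_def)
  \<comment> \<open>The cutoff off \<open>H\<close> is the normal form required by
    \<open>dual H\<close>.\<close>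
  let ?\<mu> = "\<lambda>h. if h \<in> H then \<xi> h else 0"
  have "?\<mu> \<in> dual H"
    using \<xi>(1) H_subset_L cartan_subspace[OF cartan]
    by (auto simp: dual_def subspace_add subspace_scale subset_iff)
  then obtain c where c: "\<And>h. ?\<mu> h = (\<Sum>s=1..r. c s * \<alpha>s s h)"
    by (rule simple_roots_span) blast
  define t where "t = (\<Sum>s=1..r. scale (c s) (killing_dual (\<alpha>s s)))"
  have tH: "t \<in> H"
    unfolding t_def using cartan_subspace[OF cartan] killing_dual_in simple_root_pos
    by (intro subspace_sum subspace_scale) auto
  have t: "killing t h = \<xi> h" if "h \<in> H" for h
  proof -
    have "killing t h = (\<Sum>s=1..r. c s * \<alpha>s s h)"
      unfolding t_def killing_sum_left killing_scale_left
      using killing_killing_dual simple_root_pos that by (intro sum.cong) auto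
    then show ?thesis using c[of h] that by simp
  qed
  \<comment> \<open>Both sides are the Killing pairing of \<open>t\<close> with
    \<open>killing_dual \<beta>\<close>.\<close>
  have form: "form \<xi> \<beta> = \<beta> t" if "\<beta> \<in> pos_roots" for \<beta>
    using t[OF killing_dual_in[OF that]] killing_killing_dual[OF that tH]
    by (simp add: form_def killing_commute)
  have "\<alpha>s s t = 0" if s: "s \<in> I" for s
  proof -
    have pos: "\<alpha>s s \<in> pos_roots" using simple_root_pos s I_subset by blast
    have "\<alpha>s s t = \<xi> (br (e (\<alpha>s s)) (f (\<alpha>s s)))"
      using form[OF pos] by (simp add: form_def killing_dual_eq[OF pos])
    then show ?thesis using \<xi>(2) simple_root_vectors_in_L[OF s] by simp
  qed
  then show ?thesis using that in_center_L[OF tH] form by blast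
qed

section \<open>Restriction of roots to the center\<close>

lemma finite_Ibar: "finite Ibar"
  by (simp add: Ibar_def)

lemma sum_split: "(\<Sum>s=1..r. g s) = (\<Sum>s\<in>Ibar. g s) + (\<Sum>s\<in>I. g s)"
  unfolding Ibar_def by (rule sum.subset_diff[OF I_subset]) simp

text \<open>A combination vanishing on \<open>center L\<close> vanishes on the common kernel of the
  simple roots in \<open>I\<close>, hence is a combination of those. Independence of all simple
  roots then forces its coefficients to be 0.\<close>

lemma bar_simple_roots_independent:
  assumes "\<And>z. z \<in> center L \<Longrightarrow> (\<Sum>s\<in>Ibar. c s * \<alpha>s s z) = 0" "j \<in> Ibar"
  shows "c j = 0"
proof -
  let ?g = "\<lambda>x. \<Sum>s\<in>Ibar. c s * \<alpha>s s x"
  have dual: "\<alpha>s s \<in> dual H" if "s \<in> {1..r}" for s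
    using that simple_root_pos pos_root_dual by blast
  have add: "\<alpha>s s (x + y) = \<alpha>s s x + \<alpha>s s y" if "s \<in> {1..r}" "x \<in> H" "y \<in> H" for s x y
    using dual[OF that(1)] that by (simp add: dual_def)
  have hom: "\<alpha>s s (scale a x) = a * \<alpha>s s x" if "s \<in> {1..r}" "x \<in> H" for s a x
    using dual[OF that(1)] that by (simp add: dual_def)
  have out: "\<alpha>s s x = 0" if "s \<in> {1..r}" "x \<notin> H" for s x
    using dual[OF that(1)] that by (simp add: dual_def)
  have Ir: "s \<in> {1..r}" if "s \<in> I \<or> s \<in> Ibar" for s
    using that I_subset by (auto simp: Ibar_def)
  have "\<exists>d. \<forall>x\<in>H. ?g x = (\<Sum>s\<in>I. d s * \<alpha>s s x)"
  proof (rule functional_in_span_of_kernels[OF finite_I cartan_subspace[OF cartan]])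
    fix x y assume "x \<in> H" "y \<in> H"
    then show "?g (x + y) = ?g x + ?g y"
      unfolding sum.distrib[symmetric] using add Ir
      by (intro sum.cong) (simp_all add: distrib_left)
  next
    fix a x assume "x \<in> H"
    then show "?g (scale a x) = a * ?g x"
      unfolding sum_distrib_left using hom Ir
      by (intro sum.cong) simp_all
  next
    fix x assume "x \<in> H" "\<And>s. s \<in> I \<Longrightarrow> \<alpha>s s x = 0"
    then show "?g x = 0" using assms(1) in_center_L by blast
  qed (use add hom Ir in blast)+
  then obtain d where d: "\<And>x. x \<in> H \<Longrightarrow> ?g x = (\<Sum>s\<in>I. d s * \<alpha>s s x)" by blast
  \<comment> \<open>Moves the \<open>I\<close> part to the other side, giving one linear relation
    among all simple roots.\<close>
  define k where "k s = (if s \<in> I then - d s else c s)" for s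
  have "(\<Sum>s=1..r. k s * \<alpha>s s h) = 0" for h
  proof (cases "h \<in> H")
    case True
    have "(\<Sum>s\<in>Ibar. k s * \<alpha>s s h) = ?g h"
      by (intro sum.cong) (auto simp: k_def Ibar_def)
    moreover have "(\<Sum>s\<in>I. k s * \<alpha>s s h) = - (\<Sum>s\<in>I. d s * \<alpha>s s h)"
      unfolding sum_negf[symmetric] by (intro sum.cong) (auto simp: k_def)
    ultimately show ?thesis using d[OF True] unfolding sum_split by simp
  next
    case False
    then show ?thesis using out by (intro sum.neutral) auto
  qed
  then have "k j = 0" using simple_roots_independent[of k] Ir assms(2) by blast
  then show ?thesis using assms(2) by (simp add: k_def Ibar_def)
qed

text \<open>Roots of \<open>L\<close> vanish on its center, but by independence the restriction of a
  simple root outside \<open>I\<close> is nonzero.\<close>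

lemma simple_root_not_levi:
  assumes "s \<in> Ibar"
  shows "\<alpha>s s \<in> pos_roots - pos_roots_levi"
proof -
  have "\<alpha>s s \<notin> roots H L"
  proof
    assume "\<alpha>s s \<in> roots H L"
    then have "\<alpha>s s z = 0" if "z \<in> center L" for z
      using that levi_root_center_L by blast
    then have "(\<Sum>j\<in>Ibar. (if j = s then 1 else 0) * \<alpha>s j z) = 0" if "z \<in> center L" for z
      using that by (intro sum.neutral) auto
    then have "(if s = s then 1 else 0) = (0 :: complex)"
      using assms by (rule bar_simple_roots_independent)
    then show False by simp
  qed
  then show ?thesis
    using simple_root_pos assms by (auto simp: Ibar_def pos_roots_levi_def)
qed

text \<open>Dropping the terms in \<open>I\<close> from an expansion of \<open>\<beta>\<close> gives
  an expansion of \<open>bar \<beta>\<close>, unique by independence. Thus the description defining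
  \<open>mult\<close> has exactly one solution.\<close>

lemma mult_bar:
  assumes \<beta>: "\<beta> \<in> pos_roots" and z: "z \<in> center L"
  shows "\<beta> z = (\<Sum>s\<in>Ibar. of_nat (mult (bar \<beta>) s) * \<alpha>s s z)"
proof -
  let ?P = "\<lambda>n :: nat \<Rightarrow> nat. (\<forall>s. s \<notin> Ibar \<longrightarrow> n s = 0) \<and>
     (\<forall>z. bar \<beta> z = (\<Sum>s\<in>Ibar. of_nat (n s) * bar (\<alpha>s s) z))"
  obtain m :: "nat \<Rightarrow> nat" where m: "\<And>h. \<beta> h = (\<Sum>s=1..r. of_nat (m s) * \<alpha>s s h)"
    using \<beta> by (auto simp: pos_roots_def)
  \<comment> \<open>Multiplicities are total functions; the value 0 off \<open>Ibar\<close> makes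
    them unique.\<close>
  define n where "n s = (if s \<in> Ibar then m s else 0)" for s
  have "?P n"
  proof (intro conjI allI)
    fix z
    show "bar \<beta> z = (\<Sum>s\<in>Ibar. of_nat (n s) * bar (\<alpha>s s) z)"
    proof (cases "z \<in> center L")
      case True
      then have "(\<Sum>s\<in>I. of_nat (m s) * \<alpha>s s z) = 0"
        using simple_root_center_L by (intro sum.neutral) simp
      moreover have "(\<Sum>s\<in>Ibar. of_nat (n s) * bar (\<alpha>s s) z) = (\<Sum>s\<in>Ibar. of_nat (m s) * \<alpha>s s z)"
        using True by (intro sum.cong) (auto simp: n_def bar_def)
      ultimately show ?thesis using True m[of z] unfolding sum_split by (simp add: bar_def)
    qed (simp add: bar_def)
  qed (simp add: n_def)
  moreover have "n1 = n2" if n1: "?P n1" and n2: "?P n2" for n1 n2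
  proof
    fix s
    show "n1 s = n2 s"
    proof (cases "s \<in> Ibar")
      case True
      have "(\<Sum>s\<in>Ibar. (of_nat (n1 s) - of_nat (n2 s)) * \<alpha>s s z) = 0" if z: "z \<in> center L" for z
      proof -
        have "(\<Sum>s\<in>Ibar. of_nat (n1 s) * bar (\<alpha>s s) z) = (\<Sum>s\<in>Ibar. of_nat (n2 s) * bar (\<alpha>s s) z)"
          using n1 n2 by metis
        then show ?thesis
          using z by (simp add: bar_def left_diff_distrib sum_subtractf)
      qed
      then have "of_nat (n1 s) - of_nat (n2 s) = (0 :: complex)"
        using True by (rule bar_simple_roots_independent)
      then show ?thesis by simp
    next
      case False
      then show ?thesis using n1 n2 by simp
    qed
  qed
  ultimately have "?P (mult (bar \<beta>))"
    unfolding mult_def by (intro theI[of ?P n]) blast+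
  then have "bar \<beta> z = (\<Sum>s\<in>Ibar. of_nat (mult (bar \<beta>) s) * bar (\<alpha>s s) z)" by blast
  then show ?thesis using z by (simp add: bar_def)
qed

section \<open>Evaluation at a character\<close>

lemma rel_form_bar:
  assumes "character \<xi>" "\<beta> \<in> pos_roots - pos_roots_levi"
  shows "rel_form (bar \<beta>) \<xi> = form \<xi> \<beta>"
proof -
  obtain t where t: "t \<in> center L" "\<And>\<beta>. \<beta> \<in> pos_roots \<Longrightarrow> form \<xi> \<beta> = \<beta> t"
    using character_representative[OF assms(1)] by blast
  \<comment> \<open>Both are root values at the central \<open>t\<close>, where a root agrees with
    its restriction.\<close>
  have "form \<xi> \<gamma> = form \<xi> \<beta>" if "\<gamma> \<in> pos_roots" "bar \<gamma> = bar \<beta>" for \<gamma>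
    using fun_cong[OF that(2), of t] that(1) assms(2) t by (simp add: bar_def)
  then show ?thesis
    unfolding rel_form_def using assms(2) by (intro the_equality) blast+
qed

text \<open>The product of powers of exponentials is the exponential of the expansion of
  \<open>\<beta>\<close> at the central \<open>t\<close>.\<close>

lemma chi_rel_t_of:
  assumes "character \<xi>" "\<beta> \<in> pos_roots - pos_roots_levi"
  shows "chi_rel (bar \<beta>) (t_of \<xi>) = exp (form \<xi> \<beta>)"
proof -
  obtain t where t: "t \<in> center L" "\<And>\<beta>. \<beta> \<in> pos_roots \<Longrightarrow> form \<xi> \<beta> = \<beta> t"
    using character_representative[OF assms(1)] by blast
  have "t_of \<xi> s ^ n = exp (of_nat n * \<alpha>s s t)" if "s \<in> Ibar" for s n
    using simple_root_not_levi[OF that] t(2) rel_form_bar[OF assms(1)]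
    by (simp add: t_of_def exp_of_nat_mult)
  then have "chi_rel (bar \<beta>) (t_of \<xi>) = (\<Prod>s\<in>Ibar. exp (of_nat (mult (bar \<beta>) s) * \<alpha>s s t))"
    unfolding chi_rel_def by (intro prod.cong) auto
  also have "\<dots> = exp (\<Sum>s\<in>Ibar. of_nat (mult (bar \<beta>) s) * \<alpha>s s t)"
    by (rule exp_sum[OF finite_Ibar, symmetric])
  also have "\<dots> = exp (form \<xi> \<beta>)"
    using mult_bar[OF _ t(1)] t(2) assms(2) by simp
  finally show ?thesis .
qed

lemma form_levi_root:
  assumes "character \<xi>" "\<beta> \<in> pos_roots_levi"
  shows "form \<xi> \<beta> = 0"
proof -
  obtain t where t: "t \<in> center L" "\<And>\<beta>. \<beta> \<in> pos_roots \<Longrightarrow> form \<xi> \<beta> = \<beta> t"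
    using character_representative[OF assms(1)] by blast
  then show ?thesis
    using levi_root_center_L assms(2) by (simp add: pos_roots_levi_def)
qed

lemma regular_form:
  assumes "character \<xi>" "regular \<xi>" "\<beta> \<in> pos_roots - pos_roots_levi"
  shows "form \<xi> \<beta> \<notin> two_pi_i_Z"
  using assms(2,3) rel_form_bar[OF assms(1,3)]
  unfolding regular_def rel_roots_def by (metis imageI)

text \<open>A root vector of \<open>L\<close> is a nonzero multiple of its bracket with some
  \<open>h\<close> in \<open>H\<close>, and a character vanishes on brackets. So
  \<open>\<xi>\<close> lies where the values of \<open>R\<close> are prescribed.\<close>

lemma character_in_dual_H:
  assumes "character \<xi>"
  shows "\<xi> \<in> dual_H_in_L"
proof -
  have "\<xi> x = 0" if \<beta>: "\<beta> \<in> roots H L" and x: "x \<in> weight_space H L \<beta>" for \<beta> x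
  proof -
    have "\<beta> \<in> dual H" "\<beta> \<noteq> 0" using \<beta> by (auto simp: roots_def)
    then obtain h where "\<beta> h \<noteq> 0" by (auto simp: fun_eq_iff)
    then have h: "h \<in> H" "\<beta> h \<noteq> 0" using \<open>\<beta> \<in> dual H\<close> by (auto simp: dual_def)
    have xL: "x \<in> L" and "br h x = scale (\<beta> h) x"
      using x h(1) by (auto simp: weight_space_def)
    moreover have "\<xi> (br h x) = 0" using assms xL h(1) H_subset_L by (auto simp: character_def)
    moreover have "\<xi> (scale (\<beta> h) x) = \<beta> h * \<xi> x"
      using assms xL by (simp add: character_def dual_def)
    ultimately show ?thesis using h(2) by simp
  qed
  then show ?thesis using assms by (simp add: dual_H_in_L_def character_def)
qed

section \<open>Comparison of the two tensors\<close>

lemma r_on_H_character: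
  assumes "character \<xi>"
  shows "r_on_H \<xi> = (\<Sum>\<beta>\<in>pos_roots - pos_roots_levi.
    tscale (- (1/2) * coth (form \<xi> \<beta> / 2)) (wedge (e \<beta>) (f \<beta>)))"
  \<comment> \<open>Every term for a root of \<open>L\<close> disappears through the value
    \<open>phi 0 = 0\<close>.\<close>
  using form_levi_root[OF assms] by (simp add: r_on_H_def phi_def tscale_sum)

text \<open>The sum over relative roots and over the fibres of \<open>bar\<close> collapses to one
  sum over the roots outside \<open>L\<close>; \<open>coth_half\<close> matches the
  coefficients.\<close>

lemma rho_t_of:
  assumes \<xi>: "character \<xi>"
  shows "rho (t_of \<xi>) = r_on_H \<xi>"
proof -
  let ?P = "pos_roots - pos_roots_levi"
  let ?G = "\<lambda>\<beta>. tscale (- (1/2) * coth (form \<xi> \<beta> / 2)) (wedge (e \<beta>) (f \<beta>))"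
  have coeff: "1/2 * ((1 + chi_rel (bar \<beta>) (t_of \<xi>)) / (1 - chi_rel (bar \<beta>) (t_of \<xi>)))
      = - (1/2) * coth (form \<xi> \<beta> / 2)" if "\<beta> \<in> ?P" for \<beta>
    unfolding chi_rel_t_of[OF \<xi> that] coth_half by simp
  have "rho (t_of \<xi>) = (\<Sum>\<theta>\<in>bar ` ?P. \<Sum>\<beta>\<in>{\<beta> \<in> ?P. bar \<beta> = \<theta>}.
      tscale (1/2 * ((1 + chi_rel \<theta> (t_of \<xi>)) / (1 - chi_rel \<theta> (t_of \<xi>)))) (wedge (e \<beta>) (f \<beta>)))"
    unfolding rho_def rel_roots_def tscale_sum tscale_tscale ..
  also have "\<dots> = (\<Sum>\<theta>\<in>bar ` ?P. \<Sum>\<beta>\<in>{\<beta> \<in> ?P. bar \<beta> = \<theta>}. ?G \<beta>)"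
    using coeff by (intro sum.cong refl) auto
  also have "\<dots> = (\<Sum>\<beta>\<in>?P. ?G \<beta>)"
    by (rule sum.image_gen[symmetric]) (simp add: finite_pos_roots)
  finally show ?thesis by (simp only: r_on_H_character[OF \<xi>])
qed

lemma admissible_t_of:
  assumes "character \<xi>" "regular \<xi>"
  shows "admissible (t_of \<xi>)"
  using chi_rel_t_of[OF assms(1)] regular_form[OF assms]
  by (auto simp: admissible_def rel_roots_def t_of_def exp_eq_1_iff_two_pi_i_Z)

text \<open>Regularity avoids the poles from roots outside \<open>L\<close>; for roots of
  \<open>L\<close> the pairing is 0, which \<open>no_pole\<close> permits. Hence
  \<open>\<xi>\<close> lies in \<open>D\<close>.\<close>

lemma dynamical_r_matrix_at_character:
  assumes "dynamical_r_matrix D R" "character \<xi>" "regular \<xi>"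
  shows "R \<xi> = r_on_H \<xi>"
proof -
  have "no_pole \<xi>"
    using regular_form[OF assms(2,3)] form_levi_root[OF assms(2)] by (auto simp: no_pole_def)
  then have "\<xi> \<in> D \<inter> dual_H_in_L"
    using assms(1) character_in_dual_H[OF assms(2)] by (auto simp: dynamical_r_matrix_def)
  then show ?thesis using assms(1) unfolding dynamical_r_matrix_def by blast
qed

end

text \<open>The admissibility conjunct ensures that the quotients in \<open>rho\<close> have nonzero
  denominators.\<close>

theorem lemma4p9:
  fixes scale :: "complex \<Rightarrow> 'g::ab_group_add \<Rightarrow> 'g"
    and Basis :: "'g set"
    and br :: "'g \<Rightarrow> 'g \<Rightarrow> 'g"
    and H L :: "'g set"
    and r :: nat
    and \<alpha>s :: "nat \<Rightarrow> 'g functional"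
    and I :: "nat set"
    and e f :: "'g functional \<Rightarrow> 'g"
    and D :: "'g functional set"
    and R :: "'g functional \<Rightarrow> 'g tensor2"
    and \<xi> :: "'g functional"
  assumes "levi_setting scale Basis br H r \<alpha>s I L e f"
    and "levi_setting.dynamical_r_matrix scale Basis br H r \<alpha>s L e f D R"
    and "levi_setting.character scale br L \<xi>"
    and "levi_setting.regular scale Basis br H r \<alpha>s L \<xi>"
  shows "levi_setting.admissible scale br H r \<alpha>s I L (levi_setting.t_of scale Basis br H r \<alpha>s L \<xi>)
     \<and> levi_setting.rho scale br H r \<alpha>s I L e f (levi_setting.t_of scale Basis br H r \<alpha>s L \<xi>)
       = R \<xi>"
proof -
  interpret levi_setting scale Basis br H r \<alpha>s I L e f by (rule assms(1))
  show ?thesis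
    using admissible_t_of[OF assms(3,4)] rho_t_of[OF assms(3)]
      dynamical_r_matrix_at_character[OF assms(2,3,4)]
    by simp
qed

end
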